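(* Let $p\in(1,\infty)$ be fixed and let $\boldsymbol{\alpha}=\{\alpha_n\}_{n=0}^{\infty}$ be a sequence of complex numbers with $|\alpha_n|<1$ for all $n$ and $\|\boldsymbol{\alpha}\|_{\ell^p}=\left(\sum_{n=0}^\infty|\alpha_n|^p\right)^{1/p}<\infty$. For each $n\in\mathbb{N}\cup\{0\}$ choose $\beta_n\in\partial\mathbb{D}$, and let $\{\Phi_{n+1}^{(\beta_n)}(z)\}_{n=0}^{\infty}$ be the paraorthogonal polynomials determined by $\{\alpha_n\}$ and $\{\beta_n\}$. Let $\{e^{i\theta_j^{(n+1)}}\}_{j=1}^{n+1}$ be the zeros of $\Phi_{n+1}^{(\beta_n)}(z)$, arranged so that $0\leq\theta_1^{(n+1)}<\theta_2^{(n+1)}<\cdots<\theta_{n+1}^{(n+1)}<2\pi$, and set $\theta_{n+2}^{(n+1)}=\theta_1^{(n+1)}+2\pi$. Then \[ \lim_{n\rightarrow\infty}\left[n^{1/p}\cdot\sup_{1\leq j\leq n+1}\left|\theta_{j+1}^{(n+1)}-\theta_{j}^{(n+1)}\right|\right]=0. \]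
   Context: $\mathbb{D}$ is the open unit disk in $\mathbb{C}$ and $\partial\mathbb{D}$ is the unit circle. Given a sequence $\{\alpha_n\}_{n=0}^\infty$ in $\mathbb{D}$ (the Verblunsky coefficients), the monic orthogonal polynomials on the unit circle $\{\Phi_n\}_{n=0}^\infty$ are determined by $\Phi_0(z)=1$ and the Szeg\H{o} recursion \[ \Phi_{n+1}(z)=z\Phi_n(z)-\overline{\alpha}_n\Phi_n^*(z),\qquad \Phi_n^*(z)=z^n\overline{\Phi_n(1/\overline{z})}. \] For $\beta_n\in\partial\mathbb{D}$, the degree $n+1$ paraorthogonal polynomial is \[ \Phi_{n+1}^{(\beta_n)}(z)=z\Phi_n(z)-\overline{\beta}_n\Phi_n^*(z). \] All $n+1$ zeros of $\Phi_{n+1}^{(\beta_n)}$ lie on $\partial\mathbb{D}$ and are simple. *)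

theory Defs
  imports "HOL-Analysis.Analysis" "HOL-Computational_Algebra.Polynomial"
begin

text \<open>
  The reversal (Szego dual) \<open>z^n * cnj (P (1 / cnj z))\<close> of a polynomial of degree at most \<open>n\<close>.
  It is given by its coefficients, because the displayed formula is meaningless at \<open>z = 0\<close>;
  lemma \<open>poly_szego_dual\<close> recovers the formula for \<open>z \<noteq> 0\<close>.
\<close>
definition szego_dual :: "nat \<Rightarrow> complex poly \<Rightarrow> complex poly" where
  "szego_dual n P = (\<Sum>k\<le>n. monom (cnj (coeff P (n - k))) k)"

lemma poly_szego_dual:
  assumes "degree P \<le> n" and "z \<noteq> 0"
  shows "poly (szego_dual n P) z = z ^ n * cnj (poly P (1 / cnj z))"
proof -
  have "poly P (1 / cnj z) = (\<Sum>i\<le>n. coeff P i * (1 / cnj z) ^ i)"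
    unfolding poly_altdef using assms(1) by (intro sum.mono_neutral_left) (auto simp: coeff_eq_0)
  hence "z ^ n * cnj (poly P (1 / cnj z)) = (\<Sum>i\<le>n. cnj (coeff P i) * (z ^ n * (1 / z) ^ i))"
    by (simp add: sum_distrib_left mult_ac)
  also have "\<dots> = (\<Sum>i\<le>n. cnj (coeff P i) * z ^ (n - i))"
    using assms(2) by (intro sum.cong) (auto simp: power_diff power_divide)
  also have "\<dots> = (\<Sum>k\<le>n. cnj (coeff P (n - k)) * z ^ k)"
    by (rule sum.reindex_bij_witness[of _ "\<lambda>k. n - k" "\<lambda>k. n - k"]) auto
  finally show ?thesis
    by (simp add: szego_dual_def poly_sum poly_monom)
qed

lemma degree_szego_dual: "degree (szego_dual n P) \<le> n"
  unfolding szego_dual_def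
  by (intro degree_sum_le) (auto intro: order_trans[OF degree_monom_le])

fun opuc :: "(nat \<Rightarrow> complex) \<Rightarrow> nat \<Rightarrow> complex poly" where
  "opuc \<alpha> 0 = 1"
| "opuc \<alpha> (Suc n) = [:0, 1:] * opuc \<alpha> n - smult (cnj (\<alpha> n)) (szego_dual n (opuc \<alpha> n))"

text \<open>\<open>popuc \<alpha> b n\<close> is the paraorthogonal polynomial of degree \<open>n + 1\<close> with parameter \<open>b\<close>.\<close>
definition popuc :: "(nat \<Rightarrow> complex) \<Rightarrow> complex \<Rightarrow> nat \<Rightarrow> complex poly" where
  "popuc \<alpha> b n = [:0, 1:] * opuc \<alpha> n - smult (cnj b) (szego_dual n (opuc \<alpha> n))"

lemma opuc_monic: "degree (opuc \<alpha> n) = n \<and> lead_coeff (opuc \<alpha> n) = 1"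
proof (induction n)
  case (Suc n)
  let ?P = "opuc \<alpha> n" and ?Q = "smult (cnj (\<alpha> n)) (szego_dual n (opuc \<alpha> n))"
  have ne: "?P \<noteq> 0" using Suc by auto
  have d: "degree ([:0, 1:] * ?P) = Suc n"
    using Suc ne by (subst degree_mult_eq) auto
  have q: "degree ?Q < Suc n"
    using degree_smult_le[of "cnj (\<alpha> n)" "szego_dual n ?P"] degree_szego_dual[of n ?P] by linarith
  have c: "coeff (opuc \<alpha> (Suc n)) (Suc n) = 1"
    using conjunct1[OF Suc] conjunct2[OF Suc] degree_szego_dual[of n ?P]
    by (auto simp: coeff_eq_0)
  have "degree (opuc \<alpha> (Suc n)) \<le> Suc n"
    using d q by (simp del: mult_pCons_left add: degree_diff_le)
  moreover have "degree (opuc \<alpha> (Suc n)) \<ge> Suc n"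
    using c by (intro le_degree) simp
  ultimately show ?case using c by (metis le_antisym)
qed simp

end

theory Submission imports Defs begin

text \<open>
  On the unit circle \<open>z \<Phi>\<^sub>n(z) / \<Phi>\<^sub>n\<^sup>*(z)\<close> has modulus one, and the Szego recursion gives an explicit
  continuous phase \<open>\<eta>\<^sub>n\<close> for it, with
  \<open>\<eta>\<^sub>n\<^sub>+\<^sub>1(t) = \<eta>\<^sub>n(t) + t - 2 Arg (1 - \<alpha>\<^sub>n exp(\<i>\<eta>\<^sub>n(t)))\<close>.
  Zeros of the paraorthogonal polynomial are the points where \<open>exp(\<i>\<eta>\<^sub>n) = cnj \<beta>\<^sub>n\<close>, so by the
  intermediate value theorem \<open>\<eta>\<^sub>n\<close> grows by at most \<open>2\<pi>\<close> across a gap. Since \<open>\<eta>\<^sub>n(t)\<close> differs from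
  \<open>(n + 1)t\<close> by \<open>O(\<Sum>k<n. |\<alpha>\<^sub>k|)\<close>, each gap is at most \<open>(2\<pi> + O(\<Sum>k<n. |\<alpha>\<^sub>k|)) / (n + 1)\<close>,
  and for an \<open>\<ell>\<^sup>p\<close> sequence that sum is \<open>o(n\<^sup>1\<^sup>-\<^sup>1\<^sup>/\<^sup>p)\<close>.
\<close>

section \<open>Phase of the Szego recursion on the unit circle\<close>

fun pruefer :: "(nat \<Rightarrow> complex) \<Rightarrow> nat \<Rightarrow> real \<Rightarrow> real" where
  "pruefer \<alpha> 0 t = t"
| "pruefer \<alpha> (Suc n) t = pruefer \<alpha> n t + t - 2 * Arg (1 - \<alpha> n * cis (pruefer \<alpha> n t))"

text \<open>Keeps the argument of \<open>Arg\<close> in \<open>pruefer\<close> inside the right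
  half-plane: away from zero and from the branch cut, so the principal value never jumps and the
  phase stays continuous.\<close>

lemma Re_one_minus_mult_cis_pos:
  assumes "norm (a :: complex) < 1"
  shows "Re (1 - a * cis s) > 0"
proof -
  have "Re (a * cis s) \<le> norm (a * cis s)" by (rule complex_Re_le_cmod)
  also have "\<dots> < 1" using assms by (simp add: norm_mult)
  finally show ?thesis by simp
qed

text \<open>The constant is crude so that one linear bound covers every \<open>u\<close>: from
  \<open>norm u = 1 / 2\<close> on, the trivial bound \<open>pi\<close> suffices, and below that
  \<open>Re (1 - u)\<close> is at least \<open>1 / 2\<close>, so the arctangent formula gives
  \<open>2 * norm u\<close>.\<close>

lemma abs_Arg_one_minus_le:
  fixes u :: complex
  shows "\<bar>Arg (1 - u)\<bar> \<le> 2 * pi * norm u"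
proof (cases "norm u \<ge> 1 / 2")
  case True
  have "\<bar>Arg (1 - u)\<bar> \<le> pi"
    using mpi_less_Arg[of "1 - u"] Arg_le_pi[of "1 - u"] by linarith
  also have "\<dots> \<le> pi * (2 * norm u)" using True by simp
  finally show ?thesis by (simp add: mult_ac)
next
  case False
  have re: "Re (1 - u) \<ge> 1 / 2" using False complex_Re_le_cmod[of u] by simp
  have "\<bar>Arg (1 - u)\<bar> = \<bar>arctan (Im (1 - u) / Re (1 - u))\<bar>"
    using re by (subst arg_conv_arctan) auto
  also have "\<dots> \<le> \<bar>Im (1 - u) / Re (1 - u)\<bar>" by (rule abs_arctan_le)
  also have "\<dots> = \<bar>Im u\<bar> / Re (1 - u)" using re by simp
  also have "\<dots> \<le> \<bar>Im u\<bar> / (1 / 2)" using re by (intro divide_left_mono) auto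
  also have "\<dots> \<le> 2 * norm u" using abs_Im_le_cmod[of u] by simp
  also have "\<dots> \<le> 2 * pi * norm u" using pi_gt3 by (intro mult_right_mono) auto
  finally show ?thesis .
qed

text \<open>This converts the quotient \<open>cnj u / u\<close> produced by one Szego step into the
  summand \<open>- 2 * Arg u\<close> of the phase.\<close>

lemma cis_neg_2_Arg:
  assumes "u \<noteq> 0"
  shows "cis (- 2 * Arg u) * u = cnj u"
proof -
  have u: "u = of_real (norm u) * cis (Arg u)"
    using rcis_cmod_Arg[of u] by (simp add: rcis_def)
  have "cis (- 2 * Arg u) * u = of_real (norm u) * (cis (- 2 * Arg u) * cis (Arg u))"
    by (subst (2) u) (simp add: mult_ac)
  also have "\<dots> = of_real (norm u) * cis (- Arg u)" by (simp add: cis_mult)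
  also have "\<dots> = cnj u" by (subst (3) u) (simp add: cis_cnj)
  finally show ?thesis .
qed

lemma continuous_on_pruefer:
  assumes "\<And>n. norm (\<alpha> n) < 1"
  shows "continuous_on S (pruefer \<alpha> n)"
proof (induction n)
  case 0
  have "pruefer \<alpha> 0 = (\<lambda>t. t)" by auto
  then show ?case by simp
next
  case (Suc n)
  have "1 - \<alpha> n * cis (pruefer \<alpha> n t) \<notin> \<real>\<^sub>\<le>\<^sub>0" for t
    using Re_one_minus_mult_cis_pos[OF assms] by (auto simp: complex_nonpos_Reals_iff not_le)
  then have "continuous_on S (\<lambda>t. pruefer \<alpha> n t + t - 2 * Arg (1 - \<alpha> n * cis (pruefer \<alpha> n t)))"
    using Suc by (intro continuous_intros) auto
  then show ?case by (simp add: fun_eq_iff cong: continuous_on_cong)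
qed

text \<open>Each recursion step adds \<open>t\<close> and an error of
  \<open>2 * \<bar>Arg _\<bar>\<close>, at most \<open>4 * pi * norm (\<alpha> k)\<close>, uniformly
  in \<open>t\<close>.\<close>

lemma pruefer_approx_linear:
  assumes "\<And>n. norm (\<alpha> n) < 1"
  shows "\<bar>pruefer \<alpha> n t - (n + 1) * t\<bar> \<le> 4 * pi * (\<Sum>k<n. norm (\<alpha> k))"
proof (induction n)
  case (Suc n)
  have "\<bar>Arg (1 - \<alpha> n * cis (pruefer \<alpha> n t))\<bar> \<le> 2 * pi * norm (\<alpha> n)"
    using abs_Arg_one_minus_le[of "\<alpha> n * cis (pruefer \<alpha> n t)"] by (simp add: norm_mult)
  with Suc show ?case by (simp add: algebra_simps)
qed simp

text \<open>With \<open>w\<close> the current phase factor and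
  \<open>u = 1 - \<alpha> n * w\<close>, a Szego step multiplies the dual by \<open>u\<close> and
  turns the polynomial into \<open>w * cnj u\<close> times the old dual. Since \<open>u\<close> is
  nonzero, nonvanishing of the dual propagates, and the new phase factor is
  \<open>z * w * cnj u / u\<close>.\<close>

lemma opuc_pruefer:
  assumes \<alpha>: "\<And>n. norm (\<alpha> n) < 1"
    and z_def: "z = cis t"
  shows "poly (szego_dual n (opuc \<alpha> n)) z \<noteq> 0"
    and "z * poly (opuc \<alpha> n) z = cis (pruefer \<alpha> n t) * poly (szego_dual n (opuc \<alpha> n)) z"
proof -
  let ?P = "\<lambda>n. poly (opuc \<alpha> n) z"
  let ?Q = "\<lambda>n. poly (szego_dual n (opuc \<alpha> n)) z"
  have zz: "z * cnj z = 1" by (simp add: z_def cis_cnj cis_mult)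
  have z0: "z \<noteq> 0" by (simp add: z_def)
  have "1 / cnj z = z" using zz z0 by (simp add: field_simps)
  then have Q: "?Q n = z ^ n * cnj (?P n)" for n
    using poly_szego_dual[of "opuc \<alpha> n" n z] opuc_monic[of \<alpha> n] z0 by simp
  have "?Q n \<noteq> 0 \<and> z * ?P n = cis (pruefer \<alpha> n t) * ?Q n"
  proof (induction n)
    case 0
    show ?case using Q[of 0] by (simp add: z_def)
  next
    case (Suc n)
    define w where "w = cis (pruefer \<alpha> n t)"
    define u where "u = 1 - \<alpha> n * w"
    have ww: "w * cnj w = 1" by (simp add: w_def cis_cnj cis_mult)
    have IH: "?Q n \<noteq> 0" "z * ?P n = w * ?Q n" using Suc by (auto simp: w_def)
    have u0: "u \<noteq> 0"
      using Re_one_minus_mult_cis_pos[OF \<alpha>, of n "pruefer \<alpha> n t"]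
      unfolding u_def w_def by fastforce
    have P': "?P (Suc n) = z * ?P n - cnj (\<alpha> n) * ?Q n" by simp
    also have "\<dots> = (w - cnj (\<alpha> n)) * ?Q n" by (simp add: IH algebra_simps)
    also have "w - cnj (\<alpha> n) = w * cnj u"
      using ww by (simp add: u_def algebra_simps)
    finally have P: "?P (Suc n) = w * cnj u * ?Q n" .
    \<comment> \<open>Reversal is an involution on the circle, because
      \<open>z * cnj z = 1\<close>.\<close>
    have cQ: "z ^ n * cnj (?Q n) = ?P n"
    proof -
      have "z ^ n * cnj (?Q n) = (z * cnj z) ^ n * ?P n" by (simp add: Q power_mult_distrib)
      then show ?thesis by (simp add: zz)
    qed
    have "?Q (Suc n) = z ^ Suc n * cnj (z * ?P n - cnj (\<alpha> n) * ?Q n)"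
      by (simp only: Q[of "Suc n"] P')
    also have "\<dots> = (z * cnj z) * (z ^ n * cnj (?P n)) - \<alpha> n * (z * (z ^ n * cnj (?Q n)))"
      by (simp add: algebra_simps)
    also have "\<dots> = ?Q n - \<alpha> n * (z * ?P n)" by (simp only: zz cQ Q[of n, symmetric]) simp
    also have "\<dots> = u * ?Q n" by (simp add: IH u_def algebra_simps)
    finally have Q': "?Q (Suc n) = u * ?Q n" .
    have "cis (pruefer \<alpha> (Suc n) t) = w * z * cis (- 2 * Arg u)"
      by (simp add: w_def z_def u_def cis_mult)
    then have "cis (pruefer \<alpha> (Suc n) t) * ?Q (Suc n) = w * z * (cis (- 2 * Arg u) * u) * ?Q n"
      by (simp add: Q' mult_ac del: opuc.simps pruefer.simps)
    also have "\<dots> = z * ?P (Suc n)" by (simp only: cis_neg_2_Arg[OF u0] P) (simp add: mult_ac)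
    finally show ?case using Q' u0 IH by simp
  qed
  then show "?Q n \<noteq> 0" "z * ?P n = cis (pruefer \<alpha> n t) * ?Q n" by auto
qed

section \<open>Zeros and gaps in terms of the phase\<close>

text \<open>The paraorthogonal polynomial factors as
  \<open>cis (pruefer \<alpha> n t) - cnj b\<close> times the dual, which has no zero on the
  circle.\<close>

lemma popuc_zero_iff_pruefer:
  assumes "\<And>n. norm (\<alpha> n) < 1"
  shows "poly (popuc \<alpha> b n) (cis t) = 0 \<longleftrightarrow> cis (pruefer \<alpha> n t) = cnj b"
proof -
  have "poly (popuc \<alpha> b n) (cis t) =
      (cis (pruefer \<alpha> n t) - cnj b) * poly (szego_dual n (opuc \<alpha> n)) (cis t)"
    using opuc_pruefer(2)[OF assms refl, where n = n and t = t]
    by (simp add: popuc_def algebra_simps)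
  then show ?thesis using opuc_pruefer(1)[OF assms refl, where n = n and t = t] by simp
qed

lemma popuc_gap_bound:
  assumes \<alpha>: "\<And>n. norm (\<alpha> n) < 1" and ab: "a \<le> b"
    and zero: "poly (popuc \<alpha> c n) (cis a) = 0"
    and gap: "\<And>t. a < t \<Longrightarrow> t < b \<Longrightarrow> poly (popuc \<alpha> c n) (cis t) \<noteq> 0"
  shows "(n + 1) * (b - a) \<le> 2 * pi + 8 * pi * (\<Sum>k<n. norm (\<alpha> k))"
proof -
  let ?\<eta> = "pruefer \<alpha> n"
  have "?\<eta> b - ?\<eta> a \<le> 2 * pi"
  proof (rule ccontr)
    assume *: "\<not> ?\<eta> b - ?\<eta> a \<le> 2 * pi"
    have "?\<eta> a \<le> ?\<eta> a + 2 * pi" "?\<eta> a + 2 * pi \<le> ?\<eta> b" using * pi_ge_zero by linarith+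
    \<comment> \<open>A full turn of the phase reproduces the value it has at the zero
      \<open>a\<close>. As the growth is assumed strictly larger than \<open>2 * pi\<close>, the
      point \<open>t\<close> is interior and is a forbidden zero.\<close>
    then obtain t where t: "a \<le> t" "t \<le> b" "?\<eta> t = ?\<eta> a + 2 * pi"
      using IVT'[OF _ _ ab continuous_on_pruefer[where \<alpha> = \<alpha> and n = n, OF \<alpha>]] by blast
    have "t \<noteq> a" "t \<noteq> b" using t * by auto
    moreover have "poly (popuc \<alpha> c n) (cis t) = 0"
      using zero t by (simp add: popuc_zero_iff_pruefer[OF \<alpha>] flip: cis_mult)
    ultimately show False using gap t by force
  qed
  \<comment> \<open>The linear approximation costs \<open>4 * pi\<close> times the coefficient sum
    at each of the two endpoints, hence the \<open>8 * pi\<close>.\<close>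
  with pruefer_approx_linear[where \<alpha> = \<alpha>, OF \<alpha>, of n a] pruefer_approx_linear[where \<alpha> = \<alpha>, OF \<alpha>, of n b]
  show ?thesis by (simp add: algebra_simps abs_le_iff)
qed

section \<open>Partial sums of a sequence in l^p\<close>

text \<open>A pointwise replacement for Hoelder's inequality with a free threshold \<open>s\<close>:
  above it, \<open>a powr (1 - p)\<close> is at most \<open>s powr (1 - p)\<close> because the
  exponent is negative.\<close>

lemma le_add_powr_scaled:
  fixes a s p :: real
  assumes "0 \<le> a" "0 < s" "1 < p"
  shows "a \<le> s + a powr p * s powr (1 - p)"
proof (cases "a \<le> s")
  case True
  then show ?thesis using assms by (simp add: add_increasing2)
next
  case False
  have "a = a powr p * a powr (1 - p)" using False assms by (simp flip: powr_add)
  also have "\<dots> \<le> a powr p * s powr (1 - p)"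
    using False assms by (intro mult_left_mono powr_mono2') auto
  finally show ?thesis using assms by linarith
qed

text \<open>The fixed head \<open>T\<close> is killed by the negative power of \<open>n\<close>; the
  terms from \<open>N\<close> on are small in the p-th power sum, and the threshold inequality turns
  this into a bound on their plain sum. The head and the two parts of that bound each receive
  \<open>d\<close>, a third of \<open>e\<close>.\<close>

lemma sum_over_powr_tendsto_0:
  fixes f :: "nat \<Rightarrow> real"
  assumes p: "1 < p" and f: "\<And>n. 0 \<le> f n" and sm: "summable (\<lambda>n. f n powr p)"
  shows "(\<lambda>n. real n powr (1 / p - 1) * (\<Sum>k<n. f k)) \<longlonglongrightarrow> 0"
proof (rule tendstoI)
  fix e :: real assume e: "0 < e"
  define d where "d = e / 3"
  have d: "d > 0" using e by (simp add: d_def)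
  obtain N where N: "\<And>n. n \<ge> N \<Longrightarrow> norm (\<Sum>i. f (i + n) powr p) < d powr p"
    using suminf_exist_split[OF _ sm, of "d powr p"] d by auto
  define T where "T = (\<Sum>k<N. f k)"
  have "(\<lambda>n. real n powr (1 / p - 1) * T) \<longlonglongrightarrow> 0"
  proof -
    have "1 / p - 1 < 0" using p by simp
    then have "(\<lambda>n. real n powr (1 / p - 1)) \<longlonglongrightarrow> 0"
      by (intro tendsto_neg_powr filterlim_real_sequentially)
    from tendsto_mult_left_zero[OF this] show ?thesis .
  qed
  then have "\<forall>\<^sub>F n in sequentially. dist (real n powr (1 / p - 1) * T) 0 < d"
    using d by (rule tendstoD)
  then show "\<forall>\<^sub>F n in sequentially. dist (real n powr (1 / p - 1) * (\<Sum>k<n. f k)) 0 < e"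
    using eventually_ge_at_top[of "max N 1"]
  proof eventually_elim
    case (elim n)
    \<comment> \<open>This threshold balances the two tail terms: \<open>n * s\<close> and
      \<open>d powr p * s powr (1 - p)\<close> both equal
      \<open>d * real n powr (1 - 1 / p)\<close>.\<close>
    define s where "s = d * real n powr (- 1 / p)"
    have n: "n \<ge> N" "n > 0" using elim by auto
    have s: "s > 0" using d n by (simp add: s_def)
    have tail: "(\<Sum>k=N..<n. f k powr p) \<le> d powr p"
    proof -
      have "(\<Sum>k=N..<n. f k powr p) = (\<Sum>i<n - N. f (i + N) powr p)"
        by (rule sum.reindex_bij_witness[of _ "\<lambda>i. i + N" "\<lambda>k. k - N"]) auto
      also have "\<dots> \<le> (\<Sum>i. f (i + N) powr p)"
        by (intro sum_le_suminf summable_ignore_initial_segment sm) auto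
      finally show ?thesis using N[of N] by auto
    qed
    have "(\<Sum>k<n. f k) = T + (\<Sum>k=N..<n. f k)"
      unfolding T_def using n by (metis atLeast0LessThan sum.atLeastLessThan_concat zero_le)
    also have "(\<Sum>k=N..<n. f k) \<le> (\<Sum>k=N..<n. s + f k powr p * s powr (1 - p))"
      using f s p by (intro sum_mono le_add_powr_scaled)
    also have "\<dots> = (n - N) * s + (\<Sum>k=N..<n. f k powr p) * s powr (1 - p)"
      by (simp add: sum.distrib sum_distrib_right)
    also have "\<dots> \<le> n * s + d powr p * s powr (1 - p)"
      using s tail by (intro add_mono mult_right_mono) auto
    also have "d powr p * s powr (1 - p) = d * real n powr (1 - 1 / p)"
    proof -
      have "- 1 / p * (1 - p) = 1 - 1 / p" using p by (simp add: field_simps)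
      then have "s powr (1 - p) = d powr (1 - p) * real n powr (1 - 1 / p)"
        by (simp only: s_def powr_mult powr_powr)
      moreover have "d powr p * d powr (1 - p) = d" using d by (simp flip: powr_add)
      ultimately show ?thesis by (simp flip: mult.assoc)
    qed
    also have "n * s = d * real n powr (1 - 1 / p)"
      using n powr_add[of n 1 "- 1 / p"] by (simp add: s_def)
    finally have "(\<Sum>k<n. f k) \<le> T + 2 * d * real n powr (1 - 1 / p)" by simp
    then have "real n powr (1 / p - 1) * (\<Sum>k<n. f k)
        \<le> real n powr (1 / p - 1) * (T + 2 * d * real n powr (1 - 1 / p))"
      by (rule mult_left_mono) simp
    also have "\<dots> = real n powr (1 / p - 1) * T
        + 2 * d * (real n powr (1 / p - 1) * real n powr (1 - 1 / p))"
      by (simp add: algebra_simps)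
    also have "real n powr (1 / p - 1) * real n powr (1 - 1 / p) = 1"
      using n by (simp flip: powr_add)
    finally have "real n powr (1 / p - 1) * (\<Sum>k<n. f k) < e"
      using elim(1) by (simp add: dist_real_def d_def abs_less_iff)
    moreover have "real n powr (1 / p - 1) * (\<Sum>k<n. f k) \<ge> 0"
      using f by (intro mult_nonneg_nonneg sum_nonneg) auto
    ultimately show ?case by simp
  qed
qed

section \<open>From the gap bound to the limit\<close>

theorem theorem2p1:
  fixes p :: real
    and \<alpha> \<beta> :: "nat \<Rightarrow> complex"
    and \<theta> :: "nat \<Rightarrow> nat \<Rightarrow> real"
  assumes p: "1 < p"
    and \<alpha>_disk: "\<And>n. norm (\<alpha> n) < 1"
    and \<alpha>_lp: "summable (\<lambda>n. norm (\<alpha> n) powr p)"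
    and \<beta>_circle: "\<And>n. norm (\<beta> n) = 1"
    and zeros: "\<And>n. {z. poly (popuc \<alpha> (\<beta> n) n) z = 0} = (\<lambda>j. exp (\<i> * of_real (\<theta> (n + 1) j))) ` {1..n + 1}"
    and \<theta>_first: "\<And>n. 0 \<le> \<theta> (n + 1) 1"
    and \<theta>_increasing: "\<And>n. strict_mono_on {1..n + 1} (\<theta> (n + 1))"
    and \<theta>_last: "\<And>n. \<theta> (n + 1) (n + 1) < 2 * pi"
    and \<theta>_wrap: "\<And>n. \<theta> (n + 1) (n + 2) = \<theta> (n + 1) 1 + 2 * pi"
  shows "(\<lambda>n. real n powr (1 / p) *
           (SUP j\<in>{1..n + 1}. \<bar>\<theta> (n + 1) (j + 1) - \<theta> (n + 1) j\<bar>)) \<longlonglongrightarrow> 0"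
proof -
  define B where "B n = 2 * pi + 8 * pi * (\<Sum>k<n. norm (\<alpha> k))" for n
  define gap where "gap n j = \<bar>\<theta> (n + 1) (j + 1) - \<theta> (n + 1) j\<bar>" for n j
  have gap_le: "gap n j \<le> B n / (n + 1)" if j: "j \<in> {1..n + 1}" for n j
  proof -
    let ?\<theta> = "\<theta> (n + 1)"
    note mono = \<theta>_increasing[of n, unfolded strict_mono_on_def, rule_format]
    have mono': "?\<theta> i \<le> ?\<theta> k" if "1 \<le> i" "i \<le> k" "k \<le> n + 1" for i k
      using mono[of i k] that by (cases "i = k") auto
    have range: "0 \<le> ?\<theta> i" "?\<theta> i < 2 * pi" if "1 \<le> i" "i \<le> n + 1" for i
      using mono'[of 1 i] mono'[of i "n + 1"] \<theta>_first[of n] \<theta>_last[of n] that by auto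
    have zero: "poly (popuc \<alpha> (\<beta> n) n) (cis (?\<theta> i)) = 0" if "i \<in> {1..n + 1}" for i
      using zeros[of n] that by (auto simp: cis_conv_exp)
    have wrap: "?\<theta> (j + 1) = ?\<theta> 1 + 2 * pi" if "j = n + 1"
      using \<theta>_wrap[of n] that by simp
    have le: "?\<theta> j \<le> ?\<theta> (j + 1)"
      using j mono'[of j "j + 1"] range[of j] range[of 1] wrap by (cases "j = n + 1") auto
    have "(real n + 1) * (?\<theta> (j + 1) - ?\<theta> j) \<le> B n"
      unfolding B_def
    proof (rule popuc_gap_bound[where \<alpha> = \<alpha>, OF \<alpha>_disk le zero[OF j]])
      fix t assume t: "?\<theta> j < t" "t < ?\<theta> (j + 1)"
      show "poly (popuc \<alpha> (\<beta> n) n) (cis t) \<noteq> 0"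
      proof
        assume "poly (popuc \<alpha> (\<beta> n) n) (cis t) = 0"
        then have "cis t \<in> (\<lambda>j. exp (\<i> * of_real (?\<theta> j))) ` {1..n + 1}"
          unfolding zeros[of n, symmetric] by simp
        then obtain i where i: "1 \<le> i" "i \<le> n + 1" "cis t = cis (?\<theta> i)"
          by (auto simp: cis_conv_exp)
        \<comment> \<open>A zero strictly inside the gap is some listed angle up to full turns. The
          last gap extends past \<open>2 * pi\<close>, so \<open>m = 0\<close> is not automatic;
          \<open>m < 0\<close> is excluded because \<open>t\<close> is nonnegative and the listed
          angles lie below \<open>2 * pi\<close>.\<close>
        then obtain m :: int where m: "t = ?\<theta> i + 2 * pi * m"
          using sin_cos_eq_iff[of t "?\<theta> i"] by (auto simp: complex_eq_iff)
        have tpos: "0 \<le> t" using t range[of j] j by auto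
        have "2 * pi * (-1) < 2 * pi * m" using m tpos range[OF i(1,2)] by simp
        then have "(-1 :: real) < m" by (rule mult_left_less_imp_less) simp
        then have m0: "m \<ge> 0" by linarith
        show False
        proof (cases "m = 0")
          case True
          then have "t = ?\<theta> i" using m by simp
          then have "\<not> i \<le> j" "\<not> i \<ge> j + 1 \<or> j = n + 1"
            using t mono'[of i j] mono'[of "j + 1" i] i j by auto
          then show False using i j by auto
        next
          case False
          with m0 have "2 * pi * 1 \<le> 2 * pi * real_of_int m"
            by (intro mult_left_mono) auto
          moreover have "?\<theta> 1 \<le> ?\<theta> i" using mono' i by simp
          \<comment> \<open>One full turn or more puts \<open>t\<close> at or beyond the wrapped
            angle, which no gap exceeds: earlier gaps end before \<open>2 * pi\<close>, and the last
            one ends exactly there.\<close>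
          ultimately have "t \<ge> ?\<theta> 1 + 2 * pi" using m by linarith
          then show False
            using t range[of "j + 1"] range[of 1] wrap j by (cases "j = n + 1") auto
        qed
      qed
    qed
    then show ?thesis using le by (simp add: gap_def field_simps)
  qed
  have gap_ge: "0 \<le> gap n j" for n j by (simp add: gap_def)
  have sup: "0 \<le> (SUP j\<in>{1..n + 1}. gap n j)" "(SUP j\<in>{1..n + 1}. gap n j) \<le> B n / (n + 1)" for n
  proof -
    show "(SUP j\<in>{1..n + 1}. gap n j) \<le> B n / (n + 1)"
      by (rule cSUP_least) (use gap_le in auto)
    have "gap n 1 \<le> (SUP j\<in>{1..n + 1}. gap n j)"
      by (rule cSUP_upper) auto
    with gap_ge[of n 1] show "0 \<le> (SUP j\<in>{1..n + 1}. gap n j)" by linarith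
  qed
  \<comment> \<open>The majorant is \<open>real n powr (1 / p) * (B n / n)\<close>, with the
    denominator \<open>n + 1\<close> weakened to \<open>n\<close> so that the powers combine. The
    constant in \<open>B\<close> vanishes in the limit because \<open>1 / p < 1\<close>, the
    coefficient sum by \<open>sum_over_powr_tendsto_0\<close>.\<close>
  have lim: "(\<lambda>n. 2 * pi * real n powr (1 / p - 1)
      + 8 * pi * (real n powr (1 / p - 1) * (\<Sum>k<n. norm (\<alpha> k)))) \<longlonglongrightarrow> 0"
  proof -
    have "(\<lambda>n. real n powr (1 / p - 1)) \<longlonglongrightarrow> 0"
      using p by (intro tendsto_neg_powr filterlim_real_sequentially) simp
    moreover have "(\<lambda>n. real n powr (1 / p - 1) * (\<Sum>k<n. norm (\<alpha> k))) \<longlonglongrightarrow> 0"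
      using p \<alpha>_lp by (intro sum_over_powr_tendsto_0) auto
    ultimately show ?thesis by (intro tendsto_add_zero tendsto_mult_right_zero)
  qed
  have "(\<lambda>n. real n powr (1 / p) * (SUP j\<in>{1..n + 1}. gap n j)) \<longlonglongrightarrow> 0"
  proof (rule tendsto_sandwich[OF _ _ tendsto_const lim])
    show "\<forall>\<^sub>F n in sequentially. 0 \<le> real n powr (1 / p) * (SUP j\<in>{1..n + 1}. gap n j)"
      by (intro always_eventually allI mult_nonneg_nonneg sup) simp
    show "\<forall>\<^sub>F n in sequentially. real n powr (1 / p) * (SUP j\<in>{1..n + 1}. gap n j)
        \<le> 2 * pi * real n powr (1 / p - 1)
          + 8 * pi * (real n powr (1 / p - 1) * (\<Sum>k<n. norm (\<alpha> k)))"
      using eventually_gt_at_top[of 0]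
    proof eventually_elim
      case (elim n)
      have B: "B n \<ge> 0" by (simp add: B_def sum_nonneg)
      have "real n powr (1 / p) * (SUP j\<in>{1..n + 1}. gap n j) \<le> real n powr (1 / p) * (B n / n)"
        using sup(2)[of n] divide_left_mono[of n "n + 1" "B n"] B elim
        by (intro mult_left_mono) auto
      also have "\<dots> = real n powr (1 / p - 1) * B n" using elim by (simp add: powr_diff)
      finally show ?case by (simp add: B_def algebra_simps)
    qed
  qed
  then show ?thesis by (simp add: gap_def)
qed

end
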